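(* The only numerical semigroups for which the sequence $(\nu_i)_{i\in\mathbb{N}_0}$ is non-decreasing are the ordinary numerical semigroups. That is, for a numerical semigroup $\Lambda$, the sequence $(\nu_i)$ is non-decreasing if and only if $\Lambda$ is ordinary.
   Context: $\mathbb{N}_0$ is the set of non-negative integers. A numerical semigroup is a subset $\Lambda\subseteq\mathbb{N}_0$ containing $0$, closed under addition, with finite complement in $\mathbb{N}_0$. The enumeration of $\Lambda$ is the unique increasing bijection $\lambda:\mathbb{N}_0\to\Lambda$, written $\lambda_i=\lambda(i)$. For $i\in\mathbb{N}_0$, $\nu_i=\#\{j\in\mathbb{N}_0\mid\lambda_i-\lambda_j\in\Lambda\}$. $\Lambda$ is ordinary if $\Lambda=\{0\}\cup\{i\in\mathbb{N}_0\mid i\geq c\}$ for some non-negative integer $c$ (in particular $\mathbb{N}_0$ is ordinary). *)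

theory Defs
  imports Main "HOL-Library.Infinite_Set"
begin

definition numerical_semigroup :: "nat set \<Rightarrow> bool" where
  "numerical_semigroup \<Lambda> \<longleftrightarrow>
     0 \<in> \<Lambda> \<and> (\<forall>x\<in>\<Lambda>. \<forall>y\<in>\<Lambda>. x + y \<in> \<Lambda>) \<and> finite (- \<Lambda>)"

definition ordinary :: "nat set \<Rightarrow> bool" where
  "ordinary \<Lambda> \<longleftrightarrow> (\<exists>c. \<Lambda> = {0} \<union> {i. i \<ge> c})"

(* The difference is taken in the integers: on nat it would truncate to 0, which lies in \<Lambda>. *)
definition nu :: "nat set \<Rightarrow> nat \<Rightarrow> nat" where
  "nu \<Lambda> i = card {j. int (enumerate \<Lambda> i) - int (enumerate \<Lambda> j) \<in> int ` \<Lambda>}"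

lemma numerical_semigroup_infinite:
  assumes "numerical_semigroup \<Lambda>"
  shows "infinite \<Lambda>"
  using assms finite_compl[of \<Lambda>] by (auto simp: numerical_semigroup_def)

(* The library's enumerate \<Lambda> is the increasing bijection from the naturals onto \<Lambda>. *)
lemma numerical_semigroup_enumerate:
  assumes "numerical_semigroup \<Lambda>"
  shows "strict_mono (enumerate \<Lambda>)" "bij_betw (enumerate \<Lambda>) UNIV \<Lambda>"
  using numerical_semigroup_infinite[OF assms]
  by (auto intro: strict_mono_enumerate bij_enumerate)

(* The set counted by nu is finite, so card is not the default value 0. *)
lemma finite_nu_set:
  assumes "numerical_semigroup \<Lambda>"
  shows "finite {j. int (enumerate \<Lambda> i) - int (enumerate \<Lambda> j) \<in> int ` \<Lambda>}"
proof (rule finite_subset)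
  show "{j. int (enumerate \<Lambda> i) - int (enumerate \<Lambda> j) \<in> int ` \<Lambda>} \<subseteq> {..i}"
  proof
    fix j assume "j \<in> {j. int (enumerate \<Lambda> i) - int (enumerate \<Lambda> j) \<in> int ` \<Lambda>}"
    then have "enumerate \<Lambda> j \<le> enumerate \<Lambda> i" by auto
    then show "j \<in> {..i}"
      using strict_mono_less_eq[OF numerical_semigroup_enumerate(1)[OF assms]] by simp
  qed
qed simp

end

theory Submission
  imports Defs
begin

text \<open>
  Count the ways to write \<open>s\<close> as an ordered sum of two elements of a set \<open>A\<close> containing \<open>0\<close>.
  If this count is non-decreasing along \<open>A + A\<close>, then it increases by at most one from each
  element of \<open>A + A\<close> to the next, and \<open>A + A = A\<close>.  Both claims pass to \<open>A\<close> from the set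
  \<open>{e. e + b \<in> A}\<close>, where \<open>b\<close> is the least positive element of \<open>A\<close>: a sum \<open>s > 0\<close> has two
  representations using \<open>0\<close> precisely when \<open>s \<in> A\<close>, so an \<open>s \<in> A + A\<close> outside \<open>A\<close> would have to
  make up for the two missing ones by a jump of at least two in the shifted count.

  If the sequence \<open>\<nu>\<close> of a numerical semigroup of multiplicity \<open>m\<close> is non-decreasing, this applies
  to \<open>{e. e + m \<in> \<Lambda>}\<close>.  It yields \<open>s - m \<in> \<Lambda>\<close> for all \<open>s \<in> \<Lambda>\<close> with \<open>s \<ge> 2 m\<close>, and
  descending from large numbers in steps of \<open>m\<close> shows that \<open>\<Lambda>\<close> contains everything above \<open>m\<close>.
\<close>

section \<open>Counting representations as a sum of two elements\<close>

text \<open>Stated for arbitrary sets, because the shifted sets to which the argument passes need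
  not be semigroups. The guard \<open>a \<le> s\<close> matters: truncated subtraction would
  otherwise give \<open>0\<close>, which may lie in \<open>A\<close>.\<close>

definition rep :: "nat set \<Rightarrow> nat \<Rightarrow> nat" where
  "rep A s = card {a \<in> A. a \<le> s \<and> s - a \<in> A}"

lemma finite_rep_set: "finite {a \<in> A. a \<le> s \<and> s - a \<in> A}" for s :: nat
  by (rule finite_subset[of _ "{..s}"]) auto

lemma rep_pos_iff: "rep A s > 0 \<longleftrightarrow> (\<exists>a\<in>A. \<exists>b\<in>A. s = a + b)"
proof -
  have "rep A s > 0 \<longleftrightarrow> {a \<in> A. a \<le> s \<and> s - a \<in> A} \<noteq> {}"
    unfolding rep_def using finite_rep_set by (simp add: card_gt_0_iff)
  also have "\<dots> \<longleftrightarrow> (\<exists>a\<in>A. \<exists>b\<in>A. s = a + b)"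
  proof
    assume "{a \<in> A. a \<le> s \<and> s - a \<in> A} \<noteq> {}"
    then obtain a where "a \<in> A" "a \<le> s" "s - a \<in> A" by blast
    then show "\<exists>a\<in>A. \<exists>b\<in>A. s = a + b"
      by (metis le_add_diff_inverse)
  next
    assume "\<exists>a\<in>A. \<exists>b\<in>A. s = a + b"
    then obtain a b where "a \<in> A" "b \<in> A" "s = a + b" by blast
    then have "a \<in> {a \<in> A. a \<le> s \<and> s - a \<in> A}" by simp
    then show "{a \<in> A. a \<le> s \<and> s - a \<in> A} \<noteq> {}" by blast
  qed
  finally show ?thesis .
qed

lemma rep_0: "0 \<in> A \<Longrightarrow> rep A 0 = 1"
proof -
  assume "0 \<in> A"
  then have "{a \<in> A. a \<le> 0 \<and> 0 - a \<in> A} = {0}" by auto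
  then show ?thesis by (simp add: rep_def)
qed

text \<open>The term 2 counts the trivial representations \<open>0 + s\<close> and
  \<open>s + 0\<close> of \<open>s = u + 2 * b\<close>. In every other representation both summands
  are at least \<open>b\<close>, and subtracting \<open>b\<close> from each gives a representation
  of \<open>u\<close>.\<close>

lemma rep_shift:
  assumes "0 \<in> A" "b > 0" and least: "\<And>a. a \<in> A \<Longrightarrow> a \<noteq> 0 \<Longrightarrow> b \<le> a"
  shows "rep A (u + 2 * b) = (if u + 2 * b \<in> A then 2 else 0) + rep {e. e + b \<in> A} u"
proof -
  let ?s = "u + 2 * b" and ?E = "{e. e + b \<in> A}"
  let ?Z = "if ?s \<in> A then {0, ?s} else {}"
  let ?I = "(\<lambda>e. e + b) ` {e \<in> ?E. e \<le> u \<and> u - e \<in> ?E}"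
  have "{a \<in> A. a \<le> ?s \<and> ?s - a \<in> A} = ?Z \<union> ?I"
  proof (intro equalityI subsetI)
    fix a assume a: "a \<in> {a \<in> A. a \<le> ?s \<and> ?s - a \<in> A}"
    show "a \<in> ?Z \<union> ?I"
    proof (cases "a = 0 \<or> a = ?s")
      case True
      then show ?thesis using a by auto
    next
      case False
      then have "b \<le> a" "b \<le> ?s - a" using a least by auto
      then have "u - (a - b) + b = ?s - a" "a - b \<le> u" "a = a - b + b"
        using \<open>b > 0\<close> by auto
      then have "a - b \<in> {e \<in> ?E. e \<le> u \<and> u - e \<in> ?E}" using a by auto
      then show ?thesis using \<open>a = a - b + b\<close> by blast
    qed
  next
    fix a assume "a \<in> ?Z \<union> ?I"
    then show "a \<in> {a \<in> A. a \<le> ?s \<and> ?s - a \<in> A}"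
    proof
      assume "a \<in> ?Z"
      then show ?thesis using assms(1) by (auto split: if_splits)
    next
      assume "a \<in> ?I"
      then obtain e where e: "a = e + b" "e + b \<in> A" "e \<le> u" "u - e + b \<in> A" by auto
      then have "?s - a = u - e + b" by simp
      then show ?thesis using e by simp
    qed
  qed
  moreover have "finite ?I" by (intro finite_imageI finite_rep_set)
  moreover have "?Z \<inter> ?I = {}" using \<open>b > 0\<close> by auto
  moreover have "card ?I = rep ?E u"
    unfolding rep_def by (rule card_image) (simp add: inj_on_def)
  ultimately have "rep A ?s = card ?Z + rep ?E u"
    unfolding rep_def[of A] by (simp add: card_Un_disjoint)
  then show ?thesis using \<open>b > 0\<close> by simp
qed

text \<open>Two nonzero summands already add up to \<open>2 * b\<close>, so only the trivial
  representations are left, and they differ because \<open>s > 0\<close>.\<close>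

lemma rep_small:
  assumes "0 \<in> A" and least: "\<And>a. a \<in> A \<Longrightarrow> a \<noteq> 0 \<Longrightarrow> b \<le> a"
    and s: "0 < s" "s < 2 * b"
  shows "rep A s = (if s \<in> A then 2 else 0)"
proof -
  have "a = 0 \<or> a = s" if "a \<in> A" "a \<le> s" "s - a \<in> A" for a
    using least[of a] least[of "s - a"] that s by force
  then have "a \<in> A \<and> a \<le> s \<and> s - a \<in> A \<longleftrightarrow> s \<in> A \<and> (a = 0 \<or> a = s)" for a
    using assms(1) by (metis diff_self_eq_0 diff_zero le_refl zero_le)
  then have "{a \<in> A. a \<le> s \<and> s - a \<in> A} = (if s \<in> A then {0, s} else {})"
    by auto
  then show ?thesis using s by (simp add: rep_def)
qed

section \<open>Non-decreasing counts force closure under addition\<close>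

text \<open>The claims are proved together: closure of \<open>A\<close> uses the jump bound of the
  shifted set, and the jump bound of \<open>A\<close> uses both. The bound \<open>X\<close> is
  needed because, at a minimal counterexample to closure, monotonicity of the shifted count is only
  available up to that point; it also serves as the induction measure.\<close>

lemma mono_rep_imp_closed_and_jump:
  assumes "0 \<in> A"
    and "\<And>u v. u \<le> v \<Longrightarrow> v \<le> X \<Longrightarrow> rep A u > 0 \<Longrightarrow> rep A v > 0 \<Longrightarrow> rep A u \<le> rep A v"
  shows "(\<forall>s\<le>X. rep A s > 0 \<longrightarrow> s \<in> A) \<and>
    (\<forall>s\<le>X. s > 0 \<longrightarrow> rep A s > 0 \<longrightarrow> (\<exists>y<s. rep A y > 0 \<and> rep A s \<le> rep A y + 1))"
  using assms
proof (induction X arbitrary: A rule: less_induct)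
  case (less X)
  note outer = less.IH and zero = less.prems(1) and mono = less.prems(2)
  show ?case
  proof (cases "A = {0}")
    case True
    then show ?thesis using rep_pos_iff[of A] by auto
  next
    case False
    then have ex: "\<exists>a. a \<in> A \<and> a \<noteq> 0" using zero by auto
    define b where "b = (LEAST a. a \<in> A \<and> a \<noteq> 0)"
    have bA: "b \<in> A" and "b > 0" using LeastI_ex[OF ex] by (auto simp: b_def)
    have least: "b \<le> a" if "a \<in> A" "a \<noteq> 0" for a
      unfolding b_def using that by (intro Least_le) auto
    define E where "E = {e. e + b \<in> A}"
    have zE: "0 \<in> E" using bA by (simp add: E_def)
    have shift: "rep A (u + 2 * b) = (if u + 2 * b \<in> A then 2 else 0) + rep E u" for u
      unfolding E_def using rep_shift[OF zero \<open>b > 0\<close> least] .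
    have small: "rep A s = (if s \<in> A then 2 else 0)" if "0 < s" "s < 2 * b" for s
      using rep_small[OF zero least] that by blast
    have repb: "rep A b = 2" using small[of b] bA \<open>b > 0\<close> by simp

    have closed: "s \<in> A" if "s \<le> X" "rep A s > 0" for s
      using that
    proof (induction s rule: less_induct)
      case (less x)
      show ?case
      proof (rule ccontr)
        assume "x \<notin> A"
        then have "x > 0" using zero by (cases x) auto
        then have "\<not> x < 2 * b" using small[of x] \<open>x \<notin> A\<close> less.prems by auto
        then obtain w where x: "x = w + 2 * b" by (metis add.commute le_add_diff_inverse not_less)
        have repx: "rep A x = rep E w" using shift[of w] \<open>x \<notin> A\<close> x by simp
        \<comment> \<open>By the inner induction the smaller elements of \<open>A + A\<close> lie in
          \<open>A\<close>, so they have the two trivial representations that \<open>x\<close>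
          lacks.\<close>
        have repA: "rep A (u + 2 * b) = 2 + rep E u" if "u < w" "rep E u > 0" for u
          using less.IH[of "u + 2 * b"] less.prems(1) that shift[of u] x by auto
        \<comment> \<open>For \<open>v < w\<close> the term 2 cancels; for \<open>v = w\<close> it
          occurs only on the smaller side, which even strengthens the inequality.\<close>
        have "rep E u \<le> rep E v" if "u \<le> v" "v \<le> w" "rep E u > 0" "rep E v > 0" for u v
        proof (cases "u = v")
          case False
          then have "u < w" using that by simp
          have "rep A (u + 2 * b) \<le> rep A (v + 2 * b)"
            by (rule mono) (use that less.prems(1) x shift[of u] shift[of v] in simp_all)
          then show ?thesis
            using repA[OF \<open>u < w\<close> that(3)] repA[of v] repx that x by (cases "v = w") auto
        qed simp
        moreover have "w < X" using x less.prems(1) \<open>b > 0\<close> by simp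
        ultimately have jump: "w > 0 \<Longrightarrow> rep E w > 0 \<Longrightarrow> \<exists>y<w. rep E y > 0 \<and> rep E w \<le> rep E y + 1"
          using outer[of w E] zE by blast
        show False
        proof (cases "w = 0")
          case True
          \<comment> \<open>Here \<open>x = 2 * b\<close> is represented only as
            \<open>b + b\<close>, whereas \<open>b\<close> has two representations.\<close>
          have "rep A b \<le> rep A x" using mono[of b x] x less.prems repb by simp
          then show False using repb repx True rep_0[OF zE] by simp
        next
          case False
          then obtain y where y: "y < w" "rep E y > 0" "rep E w \<le> rep E y + 1"
            using jump repx less.prems by auto
          \<comment> \<open>This says \<open>2 + rep E y \<le> rep E w\<close>, against the jump
            bound at \<open>w\<close>.\<close>
          have "rep A (y + 2 * b) \<le> rep A x"
            using mono[of "y + 2 * b" x] x less.prems y repA[of y] by simp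
          then show False using y repA[of y] repx by simp
        qed
      qed
    qed

    \<comment> \<open>Witnesses: \<open>0\<close>, with count 1, if \<open>s\<close> has only its
      trivial representations; \<open>b\<close>, with count 2, if \<open>s = 2 * b\<close>, whose
      count is 3; otherwise the witness for \<open>E\<close> shifted by
      \<open>2 * b\<close>.\<close>
    have "\<exists>y<s. rep A y > 0 \<and> rep A s \<le> rep A y + 1" if s: "s \<le> X" "s > 0" "rep A s > 0" for s
    proof (cases "s < 2 * b")
      case True
      then show ?thesis using small[of s] s rep_0[OF zero] by (intro exI[of _ 0]) auto
    next
      case False
      then obtain w where w: "s = w + 2 * b" by (metis add.commute le_add_diff_inverse not_less)
      have repA: "rep A (u + 2 * b) = 2 + rep E u" if "u \<le> w" "rep E u > 0" for u
        using closed[of "u + 2 * b"] s that shift[of u] w by auto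
      have reps: "rep A s = 2 + rep E w" using closed[of s] s shift[of w] w by simp
      consider "rep E w = 0" | "w = 0" | "w > 0" "rep E w > 0" by blast
      then show ?thesis
      proof cases
        case 1
        then show ?thesis using reps s rep_0[OF zero] by (intro exI[of _ 0]) auto
      next
        case 2
        then show ?thesis
          using reps rep_0[OF zE] repb w \<open>b > 0\<close> by (intro exI[of _ b]) auto
      next
        case 3
        have "rep E u \<le> rep E v" if "u \<le> v" "v \<le> w" "rep E u > 0" "rep E v > 0" for u v
          using mono[of "u + 2 * b" "v + 2 * b"] repA[of u] repA[of v] that s w by simp
        moreover have "w < X" using w s \<open>b > 0\<close> by simp
        ultimately obtain y where "y < w" "rep E y > 0" "rep E w \<le> rep E y + 1"
          using outer[of w E] zE 3 by blast
        then show ?thesis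
          using repA[of y] reps w by (intro exI[of _ "y + 2 * b"]) auto
      qed
    qed
    then show ?thesis using closed by blast
  qed
qed

section \<open>Application to numerical semigroups\<close>

text \<open>The bijection \<open>enumerate \<Lambda>\<close> carries the indices counted by
  \<open>nu\<close> to the summands counted by \<open>rep\<close>.\<close>

lemma nu_eq_rep:
  assumes "numerical_semigroup \<Lambda>"
  shows "nu \<Lambda> i = rep \<Lambda> (enumerate \<Lambda> i)"
proof -
  let ?e = "enumerate \<Lambda>"
  have bij: "bij_betw ?e UNIV \<Lambda>" by (rule numerical_semigroup_enumerate(2)[OF assms])
  have diff: "int s - int a \<in> int ` \<Lambda> \<longleftrightarrow> a \<le> s \<and> s - a \<in> \<Lambda>" for s a
  proof
    assume "int s - int a \<in> int ` \<Lambda>"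
    then obtain b where "b \<in> \<Lambda>" "int s - int a = int b" by blast
    then have "s = a + b" by linarith
    then show "a \<le> s \<and> s - a \<in> \<Lambda>" using \<open>b \<in> \<Lambda>\<close> by simp
  next
    assume "a \<le> s \<and> s - a \<in> \<Lambda>"
    then show "int s - int a \<in> int ` \<Lambda>" by (metis imageI of_nat_diff)
  qed
  have "?e ` {j. int (?e i) - int (?e j) \<in> int ` \<Lambda>} = {a \<in> \<Lambda>. a \<le> ?e i \<and> ?e i - a \<in> \<Lambda>}"
    unfolding diff using bij by (auto simp: bij_betw_def)
  moreover have "inj_on ?e {j. int (?e i) - int (?e j) \<in> int ` \<Lambda>}"
    using bij by (auto simp: bij_betw_def intro: inj_on_subset)
  ultimately show ?thesis unfolding nu_def rep_def using card_image by fastforce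
qed

lemma mono_nu_iff:
  assumes "numerical_semigroup \<Lambda>"
  shows "mono (nu \<Lambda>) \<longleftrightarrow> (\<forall>s\<in>\<Lambda>. \<forall>t\<in>\<Lambda>. s \<le> t \<longrightarrow> rep \<Lambda> s \<le> rep \<Lambda> t)"
proof -
  note e = numerical_semigroup_enumerate[OF assms]
  let ?e = "enumerate \<Lambda>"
  have "mono (nu \<Lambda>) \<longleftrightarrow> (\<forall>i j. ?e i \<le> ?e j \<longrightarrow> rep \<Lambda> (?e i) \<le> rep \<Lambda> (?e j))"
    unfolding mono_def nu_eq_rep[OF assms] strict_mono_less_eq[OF e(1)] ..
  also have "\<dots> \<longleftrightarrow> (\<forall>s\<in>range ?e. \<forall>t\<in>range ?e. s \<le> t \<longrightarrow> rep \<Lambda> s \<le> rep \<Lambda> t)"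
    by blast
  also have "range ?e = \<Lambda>" using e(2) by (simp add: bij_betw_def)
  finally show ?thesis .
qed

text \<open>Send the summand \<open>s\<close> to \<open>t\<close> and fix all others: if
  \<open>a < s\<close>, then \<open>s - a\<close> is at least the conductor \<open>c\<close>, hence
  so is \<open>t - a\<close>.\<close>

lemma ordinary_imp_rep_le:
  assumes "ordinary \<Lambda>" "s \<in> \<Lambda>" "t \<in> \<Lambda>" "s \<le> t"
  shows "rep \<Lambda> s \<le> rep \<Lambda> t"
proof -
  obtain c where c: "\<Lambda> = {0} \<union> {i. i \<ge> c}" using assms(1) by (auto simp: ordinary_def)
  show ?thesis
    unfolding rep_def
    using finite_rep_set
  proof (rule card_inj_on_le[rotated 2])
    let ?f = "\<lambda>a. if a = s then t else a"
    show "inj_on ?f {a \<in> \<Lambda>. a \<le> s \<and> s - a \<in> \<Lambda>}"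
      using assms(4) by (auto simp: inj_on_def)
    show "?f ` {a \<in> \<Lambda>. a \<le> s \<and> s - a \<in> \<Lambda>} \<subseteq> {a \<in> \<Lambda>. a \<le> t \<and> t - a \<in> \<Lambda>}"
    proof
      fix x assume "x \<in> ?f ` {a \<in> \<Lambda>. a \<le> s \<and> s - a \<in> \<Lambda>}"
      then obtain a where a: "a \<in> \<Lambda>" "a \<le> s" "s - a \<in> \<Lambda>" and x: "x = ?f a" by blast
      show "x \<in> {a \<in> \<Lambda>. a \<le> t \<and> t - a \<in> \<Lambda>}"
      proof (cases "a = s")
        case True
        then show ?thesis using x assms(3) c by simp
      next
        case False
        then have "s - a \<noteq> 0" using a(2) by simp
        then have "c \<le> s - a" using a(3) c by simp
        then have "c \<le> t - a" using assms(4) by simp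
        then show ?thesis using False a x assms(4) c by simp
      qed
    qed
  qed
qed

lemma mono_rep_imp_ordinary:
  assumes sg: "numerical_semigroup \<Lambda>"
    and mono: "\<And>s t. s \<in> \<Lambda> \<Longrightarrow> t \<in> \<Lambda> \<Longrightarrow> s \<le> t \<Longrightarrow> rep \<Lambda> s \<le> rep \<Lambda> t"
  shows "ordinary \<Lambda>"
proof -
  have zero: "0 \<in> \<Lambda>" and add: "\<And>x y. x \<in> \<Lambda> \<Longrightarrow> y \<in> \<Lambda> \<Longrightarrow> x + y \<in> \<Lambda>"
    and fin: "finite (- \<Lambda>)"
    using sg by (auto simp: numerical_semigroup_def)
  have "\<not> \<Lambda> \<subseteq> {0}" using numerical_semigroup_infinite[OF sg] finite_subset by blast
  then have ex: "\<exists>a. a \<in> \<Lambda> \<and> a \<noteq> 0" by auto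
  define m where "m = (LEAST a. a \<in> \<Lambda> \<and> a \<noteq> 0)"
  have mL: "m \<in> \<Lambda>" and "m > 0" using LeastI_ex[OF ex] by (auto simp: m_def)
  have least: "m \<le> a" if "a \<in> \<Lambda>" "a \<noteq> 0" for a
    unfolding m_def using that by (intro Least_le) auto
  define E where "E = {e. e + m \<in> \<Lambda>}"
  have zE: "0 \<in> E" using mL by (simp add: E_def)
  have shift: "rep \<Lambda> (u + 2 * m) = 2 + rep E u" if "u + 2 * m \<in> \<Lambda>" for u
    using rep_shift[OF zero \<open>m > 0\<close> least, of u] that by (simp add: E_def)
  have sum: "u + 2 * m \<in> \<Lambda>" if pos: "rep E u > 0" for u
  proof -
    obtain a b where "a + m \<in> \<Lambda>" "b + m \<in> \<Lambda>" "u = a + b"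
      using pos by (auto simp: rep_pos_iff E_def)
    then show ?thesis using add[of "a + m" "b + m"] by (simp add: mult_2 add.assoc add.left_commute)
  qed
  \<comment> \<open>By \<open>sum\<close> both shifted elements lie in \<open>\<Lambda>\<close>, so
    the same term 2 cancels on both sides.\<close>
  have "rep E u \<le> rep E v" if "u \<le> v" "rep E u > 0" "rep E v > 0" for u v
    using mono[of "u + 2 * m" "v + 2 * m"] shift[of u] shift[of v] sum that by simp
  then have closed: "rep E u > 0 \<Longrightarrow> u \<in> E" for u
    using mono_rep_imp_closed_and_jump[OF zE, of u] by blast
  have down: "u + m \<in> \<Lambda>" if "u + 2 * m \<in> \<Lambda>" for u
  proof -
    have "2 * m \<in> \<Lambda>" using add[OF mL mL] by (simp add: mult_2)
    \<comment> \<open>The element \<open>2 * m\<close> has count 3, thanks to \<open>m + m\<close>.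
      Hence \<open>u + 2 * m\<close> also has a representation with two nonzero summands, and
      \<open>u\<close> is a sum of two elements of \<open>E\<close>.\<close>
    then have "rep \<Lambda> (0 + 2 * m) \<le> rep \<Lambda> (u + 2 * m)" using mono[of "0 + 2 * m" "u + 2 * m"] that by simp
    then have "rep E u > 0" using shift[of 0] shift[of u] rep_0[OF zE] that \<open>2 * m \<in> \<Lambda>\<close> by simp
    then show ?thesis using closed by (simp add: E_def)
  qed
  have descend: "u + m + k * m \<in> \<Lambda> \<Longrightarrow> u + m \<in> \<Lambda>" for u k
  proof (induction k)
    case (Suc k)
    have "u + m + Suc k * m = u + k * m + 2 * m" by simp
    then have "u + k * m + m \<in> \<Lambda>" using Suc.prems by (intro down) (simp only:)
    then have "u + m + k * m \<in> \<Lambda>" by (simp only: add.assoc add.commute[of "k * m"])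
    then show ?case by (rule Suc.IH)
  qed simp
  obtain B where B: "\<And>x. x \<notin> \<Lambda> \<Longrightarrow> x < B" using fin by (auto simp: finite_nat_set_iff_bounded)
  have "i \<in> \<Lambda>" if "i \<ge> m" for i
  proof -
    \<comment> \<open>Since \<open>m \<ge> 1\<close>, going up \<open>B\<close> steps of length
      \<open>m\<close> passes every gap.\<close>
    have "B \<le> B * m" using \<open>m > 0\<close> by simp
    then have "\<not> i - m + m + B * m < B" by linarith
    then have "i - m + m + B * m \<in> \<Lambda>" by (rule contrapos_np) (rule B)
    then show ?thesis using descend[of "i - m" B] that by simp
  qed
  then have "\<Lambda> = {0} \<union> {i. i \<ge> m}" using zero least by auto
  then show ?thesis by (auto simp: ordinary_def)
qed

theorem theorem7p3:
  fixes \<Lambda> :: "nat set"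
  assumes "numerical_semigroup \<Lambda>"
  shows "mono (nu \<Lambda>) \<longleftrightarrow> ordinary \<Lambda>"
  unfolding mono_nu_iff[OF assms]
proof
  assume "\<forall>s\<in>\<Lambda>. \<forall>t\<in>\<Lambda>. s \<le> t \<longrightarrow> rep \<Lambda> s \<le> rep \<Lambda> t"
  then show "ordinary \<Lambda>" by (intro mono_rep_imp_ordinary[OF assms]) simp
qed (simp add: ordinary_imp_rep_le)

end
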